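(* Let $G$ be a topological group and let $G_c$ be the closed subgroup of $G$ generated by all compact elements of $G$ (it is a normal subgroup). (i) If $G=G_c$ (that is, $G$ is the closure of the subgroup generated by all compact elements of $G$), then each continuous semipolynomial on $G$ is a constant. (ii) If $G/G_c$ is commutative, then all continuous semipolynomials on $G$ are polynomials.
   Context: Let $G$ be a topological group (discrete groups are a special case). An element $h\in G$ is called compact if the closure of the cyclic subgroup generated by $h$ is compact. $C(G)$ is the space of continuous functions $f:G\to\mathbb{C}$. For $h\in G$, $(R_hf)(x)=f(xh)$ and $\Delta_h=R_h-1$, i.e. $(\Delta_hf)(x)=f(xh)-f(x)$. A function $f$ is a polynomial of degree at most $n$ if $\Delta_{h_{n+1}}\cdots\Delta_{h_1}f=0$ for all $h_1,\dots,h_{n+1}\in G$; it is a semipolynomial of degree at most $n$ if $\Delta_h^{n+1}f=0$ for all $h\in G$. A (semi)polynomial is a function that is a (semi)polynomial of degree at most $n$ for some $n\ge 0$. *)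

theory Defs
  imports "HOL-Algebra.Algebra" "HOL-Analysis.Analysis"
begin

text \<open>No separation axiom is imposed on the topology.\<close>

locale topological_group = group G for G (structure) +
  fixes T :: "'a topology"
  assumes topspace_eq: "topspace T = carrier G"
    and continuous_mult: "continuous_map (prod_topology T T) T (\<lambda>(x, y). x \<otimes> y)"
    and continuous_inv: "continuous_map T T (\<lambda>x. inv x)"

definition compact_elements :: "('a, 'b) monoid_scheme \<Rightarrow> 'a topology \<Rightarrow> 'a set" where
  "compact_elements G T = {h \<in> carrier G. compactin T (T closure_of (generate G {h}))}"

definition compact_closed_subgroup :: "('a, 'b) monoid_scheme \<Rightarrow> 'a topology \<Rightarrow> 'a set" where
  "compact_closed_subgroup G T = T closure_of (generate G (compact_elements G T))"

definition right_translate :: "('a, 'b) monoid_scheme \<Rightarrow> 'a \<Rightarrow> ('a \<Rightarrow> complex) \<Rightarrow> 'a \<Rightarrow> complex" where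
  "right_translate G h f = (\<lambda>x. f (x \<otimes>\<^bsub>G\<^esub> h))"

definition right_diff :: "('a, 'b) monoid_scheme \<Rightarrow> 'a \<Rightarrow> ('a \<Rightarrow> complex) \<Rightarrow> 'a \<Rightarrow> complex" where
  "right_diff G h f = (\<lambda>x. right_translate G h f x - f x)"

text \<open>Functions on the group are functions on the whole type of which only the values on the
  carrier matter, so the vanishing of a function is required on the carrier only. The fold applies
  the difference operator of the head of the list first.\<close>

definition polynomial_of_degree_le :: "('a, 'b) monoid_scheme \<Rightarrow> nat \<Rightarrow> ('a \<Rightarrow> complex) \<Rightarrow> bool" where
  "polynomial_of_degree_le G n f \<longleftrightarrow>
    (\<forall>hs. length hs = n + 1 \<and> set hs \<subseteq> carrier G \<longrightarrow>
      (\<forall>x\<in>carrier G. fold (right_diff G) hs f x = 0))"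

definition semipolynomial_of_degree_le :: "('a, 'b) monoid_scheme \<Rightarrow> nat \<Rightarrow> ('a \<Rightarrow> complex) \<Rightarrow> bool" where
  "semipolynomial_of_degree_le G n f \<longleftrightarrow>
    (\<forall>h\<in>carrier G. \<forall>x\<in>carrier G. (right_diff G h ^^ (n + 1)) f x = 0)"

definition polynomial_on_group :: "('a, 'b) monoid_scheme \<Rightarrow> ('a \<Rightarrow> complex) \<Rightarrow> bool" where
  "polynomial_on_group G f \<longleftrightarrow> (\<exists>n. polynomial_of_degree_le G n f)"

definition semipolynomial_on_group :: "('a, 'b) monoid_scheme \<Rightarrow> ('a \<Rightarrow> complex) \<Rightarrow> bool" where
  "semipolynomial_on_group G f \<longleftrightarrow> (\<exists>n. semipolynomial_of_degree_le G n f)"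

end

theory Submission imports Defs begin

text \<open>
  If h is a compact element and f is a continuous semipolynomial, then f(x h^k) is a bounded
  polynomial in k, hence constant. So f is invariant under right translation by compact elements,
  and by continuity under right translation by G_c. This gives (i), and it makes f descend to a
  semipolynomial on G/G_c.

  On a commutative group, the expansion of the n-th power of a difference operator has the form
  sum_{j <= n} f_j(x y^j) = 0 where f_0 may be normalised to f. Substituting x u^n for x and u^-1 y
  for y and subtracting eliminates f_n and replaces f_0 by its difference along u^n; iterating
  yields a vanishing product of differences of f. A semipolynomial with zero difference
  along u^n is periodic along u, so again bounded along u, and has zero difference along u: this
  replaces each step u^n by u without dividing by n.
\<close>

section \<open>Difference operators on an arbitrary group\<close>

context group
begin

lemma group_hom_conj:
  assumes a: "a \<in> carrier G"
  shows "group_hom G G (\<lambda>x. a \<otimes> x \<otimes> inv a)"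
proof -
  have "a \<otimes> (x \<otimes> y) \<otimes> inv a = (a \<otimes> x \<otimes> inv a) \<otimes> (a \<otimes> y \<otimes> inv a)"
    if "x \<in> carrier G" "y \<in> carrier G" for x y
  proof -
    have "(a \<otimes> x \<otimes> inv a) \<otimes> (a \<otimes> y \<otimes> inv a) = a \<otimes> x \<otimes> (inv a \<otimes> a) \<otimes> y \<otimes> inv a"
      using a that by (simp only: m_assoc m_closed inv_closed)
    also have "\<dots> = a \<otimes> (x \<otimes> y) \<otimes> inv a"
      using a that by simp (simp add: m_assoc)
    finally show ?thesis by simp
  qed
  then have "(\<lambda>x. a \<otimes> x \<otimes> inv a) \<in> hom G G"
    using a by (auto simp: hom_def)
  then show ?thesis by (simp add: group_hom_def group_hom_axioms_def)
qed

text \<open>With base point and steps in the carrier, every evaluation point stays there. This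
  replaces rewriting by an equation of functions wherever two functions agree on the carrier
  only.\<close>

lemma fold_right_diff_cong:
  assumes "\<And>x. x \<in> carrier G \<Longrightarrow> f x = g x" "set hs \<subseteq> carrier G" "x \<in> carrier G"
  shows "fold (right_diff G) hs f x = fold (right_diff G) hs g x"
  using assms
proof (induction hs arbitrary: f g)
  case (Cons h hs)
  have "fold (right_diff G) hs (right_diff G h f) x = fold (right_diff G) hs (right_diff G h g) x"
    using Cons.prems by (intro Cons.IH) (auto simp: right_diff_def right_translate_def)
  then show ?case by simp
qed simp

text \<open>Makes the facts about \<open>fold\<close> applicable to semipolynomials as well as
  polynomials.\<close>

lemma funpow_right_diff_eq_fold:
  "(right_diff G h ^^ m) f = fold (right_diff G) (replicate m h) f"
  by (induction m arbitrary: f) (simp_all add: funpow_swap1)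

lemma fold_right_diff_hom:
  assumes "\<phi> \<in> hom G H" "set hs \<subseteq> carrier G" "x \<in> carrier G"
  shows "fold (right_diff G) hs (\<lambda>y. F (\<phi> y)) x = fold (right_diff H) (map \<phi> hs) F (\<phi> x)"
  using assms(2)
proof (induction hs arbitrary: F)
  case (Cons h hs)
  have "fold (right_diff G) (h # hs) (\<lambda>y. F (\<phi> y)) x
      = fold (right_diff G) hs (\<lambda>y. right_diff H (\<phi> h) F (\<phi> y)) x"
    using Cons.prems assms
    by (simp, intro fold_right_diff_cong)
      (auto simp: right_diff_def right_translate_def hom_mult)
  then show ?case using Cons by simp
qed simp

text \<open>A bounded polynomial sequence is constant. By induction on the degree the difference
  along \<open>h\<close> is itself constant along \<open>h\<close>, so \<open>f\<close> is affine on
  each orbit, and boundedness forces its slope to vanish.\<close>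

lemma right_diff_zero_if_bounded:
  assumes h: "h \<in> carrier G"
    and bounded: "\<And>x. x \<in> carrier G \<Longrightarrow> bounded (range (\<lambda>k::nat. f (x \<otimes> h [^] k)))"
    and zero: "\<And>x. x \<in> carrier G \<Longrightarrow> (right_diff G h ^^ (n + 1)) f x = 0"
    and x: "x \<in> carrier G"
  shows "right_diff G h f x = 0"
  using bounded zero x
proof (induction n arbitrary: f x)
  case (Suc n)
  let ?g = "right_diff G h f"
  have g0: "right_diff G h ?g y = 0" if y: "y \<in> carrier G" for y
  proof (rule Suc.IH[OF _ _ y])
    fix z assume z: "z \<in> carrier G"
    \<comment> \<open>On an orbit \<open>?g\<close> is the difference of the values of
      \<open>f\<close> on the orbits from \<open>z \<otimes> h\<close> and from \<open>z\<close>;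
      this is why boundedness is carried for all starting points.\<close>
    have "range (\<lambda>k::nat. ?g (z \<otimes> h [^] k)) \<subseteq>
        (\<lambda>(a, b). a - b) ` (range (\<lambda>k::nat. f ((z \<otimes> h) \<otimes> h [^] k)) \<times> range (\<lambda>k::nat. f (z \<otimes> h [^] k)))"
      using z h by (auto simp: right_diff_def right_translate_def m_assoc nat_pow_Suc2[symmetric])
    moreover have "bounded \<dots>"
      using Suc.prems(1)[of "z \<otimes> h"] Suc.prems(1)[of z] z h
      by (intro bounded_minus) auto
    ultimately show "bounded (range (\<lambda>k::nat. ?g (z \<otimes> h [^] k)))"
      by (rule bounded_subset[rotated])
    show "(right_diff G h ^^ (n + 1)) ?g z = 0"
      using Suc.prems(2)[OF z] by (simp add: funpow_swap1)
  qed
  have step: "f (y \<otimes> h) = f y + ?g y" for y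
    by (simp add: right_diff_def right_translate_def)
  have gconst: "?g (x \<otimes> h [^] k) = ?g x" for k :: nat
  proof (induction k)
    case (Suc k)
    have "?g (x \<otimes> h [^] k \<otimes> h) = ?g (x \<otimes> h [^] k)"
      using g0[of "x \<otimes> h [^] k"] \<open>x \<in> carrier G\<close> h
      by (simp add: right_diff_def[of G h ?g] right_translate_def)
    then show ?case using Suc \<open>x \<in> carrier G\<close> h by (simp add: m_assoc)
  qed (use \<open>x \<in> carrier G\<close> in simp)
  have linear: "f (x \<otimes> h [^] k) = f x + of_nat k * ?g x" for k :: nat
  proof (induction k)
    case (Suc k)
    then show ?case
      using step[of "x \<otimes> h [^] k"] gconst[of k] \<open>x \<in> carrier G\<close> h
      by (simp add: m_assoc algebra_simps)
  qed (use \<open>x \<in> carrier G\<close> in simp)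
  obtain B where B: "\<And>k::nat. norm (f (x \<otimes> h [^] k)) \<le> B"
    using Suc.prems(1)[OF \<open>x \<in> carrier G\<close>] by (auto simp: bounded_iff)
  have bound: "real k * norm (?g x) \<le> B + norm (f x)" for k :: nat
  proof -
    have "real k * norm (?g x) = norm (f (x \<otimes> h [^] k) - f x)"
      by (simp add: linear norm_mult)
    also have "\<dots> \<le> norm (f (x \<otimes> h [^] k)) + norm (f x)" by (rule norm_triangle_ineq4)
    finally show ?thesis using B[of k] by linarith
  qed
  show ?case
  proof (rule ccontr)
    assume "?g x \<noteq> 0"
    then obtain k :: nat where "B + norm (f x) < real k * norm (?g x)"
      using reals_Archimedean3[of "norm (?g x)"] by auto
    then show False using bound[of k] by linarith
  qed
qed simp

text \<open>The values of \<open>f\<close> along powers of \<open>h\<close> are periodic with period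
  \<open>m\<close>, so they form a finite, hence bounded, set and the preceding lemma
  applies.\<close>

lemma right_diff_zero_if_right_diff_pow_zero:
  assumes h: "h \<in> carrier G" and m: "m > 0"
    and semi: "semipolynomial_of_degree_le G n f"
    and zero: "\<And>x. x \<in> carrier G \<Longrightarrow> right_diff G (h [^] (m::nat)) f x = 0"
    and x: "x \<in> carrier G"
  shows "right_diff G h f x = 0"
proof (rule right_diff_zero_if_bounded[OF h _ _ x])
  fix y assume y: "y \<in> carrier G"
  show "(right_diff G h ^^ (n + 1)) f y = 0"
    using semi h y by (auto simp: semipolynomial_of_degree_le_def)
  have period: "f (y \<otimes> h [^] (r + m * q)) = f (y \<otimes> h [^] r)" for r q :: nat
  proof (induction q)
    case (Suc q)
    have "f (y \<otimes> h [^] (r + m * q) \<otimes> h [^] m) = f (y \<otimes> h [^] (r + m * q))"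
      using zero[of "y \<otimes> h [^] (r + m * q)"] y h
      by (simp add: right_diff_def right_translate_def)
    then show ?case using Suc y h by (simp add: m_assoc nat_pow_mult ac_simps)
  qed simp
  have "f (y \<otimes> h [^] k) \<in> (\<lambda>k. f (y \<otimes> h [^] k)) ` {..<m}" for k :: nat
    using period[of "k mod m" "k div m"] m by (metis imageI lessThan_iff mod_less_divisor mod_mult_div_eq)
  then have "range (\<lambda>k::nat. f (y \<otimes> h [^] k)) \<subseteq> (\<lambda>k. f (y \<otimes> h [^] k)) ` {..<m}"
    by auto
  then show "bounded (range (\<lambda>k::nat. f (y \<otimes> h [^] k)))"
    by (metis finite_imageI finite_imp_bounded finite_lessThan finite_subset)
qed

text \<open>The coefficients are the signed binomial coefficients (-1)^(m-j) (m choose j), described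
  by their recurrence. They are chosen before \<open>f\<close>, \<open>h\<close> and
  \<open>x\<close>, and \<open>c 0 \<noteq> 0\<close> permits normalising the term without a power
  of \<open>h\<close>.\<close>

lemma funpow_right_diff_expansion:
  "\<exists>c :: nat \<Rightarrow> complex. c 0 \<noteq> 0 \<and>
    (\<forall>f. \<forall>h\<in>carrier G. \<forall>x\<in>carrier G.
      (right_diff G h ^^ m) f x = (\<Sum>j\<le>m. c j * f (x \<otimes> h [^] j)))"
proof (induction m)
  case 0
  show ?case by (rule exI[of _ "\<lambda>_. 1"]) simp
next
  case (Suc m)
  then obtain c :: "nat \<Rightarrow> complex" where c0: "c 0 \<noteq> 0"
    and c: "\<And>f h x. h \<in> carrier G \<Longrightarrow> x \<in> carrier G \<Longrightarrow>
      (right_diff G h ^^ m) f x = (\<Sum>j\<le>m. c j * f (x \<otimes> h [^] j))"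
    by blast
  \<comment> \<open>Pascal's rule: the coefficients of the shifted sum minus those of the original.
    The guard cuts off \<open>c (Suc m)\<close>, about which nothing is known.\<close>
  define d where "d j = (case j of 0 \<Rightarrow> 0 | Suc i \<Rightarrow> c i) - (if j \<le> m then c j else 0)" for j
  have "(right_diff G h ^^ Suc m) f x = (\<Sum>j\<le>Suc m. d j * f (x \<otimes> h [^] j))"
    if h: "h \<in> carrier G" and x: "x \<in> carrier G" for f h x
  proof -
    have "(right_diff G h ^^ Suc m) f x
        = (\<Sum>j\<le>m. c j * f (x \<otimes> h [^] Suc j)) - (\<Sum>j\<le>m. c j * f (x \<otimes> h [^] j))"
      using h x by (simp add: right_diff_def[of _ _ "(right_diff G h ^^ m) f"] right_translate_def
          c m_assoc nat_pow_Suc2[symmetric] del: nat_pow_Suc)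
    also have "(\<Sum>j\<le>m. c j * f (x \<otimes> h [^] Suc j))
        = (\<Sum>j\<le>Suc m. (case j of 0 \<Rightarrow> 0 | Suc i \<Rightarrow> c i) * f (x \<otimes> h [^] j))"
      by (subst sum.atMost_Suc_shift) simp
    also have "(\<Sum>j\<le>m. c j * f (x \<otimes> h [^] j))
        = (\<Sum>j\<le>Suc m. (if j \<le> m then c j else 0) * f (x \<otimes> h [^] j))"
      by simp
    finally show ?thesis
      by (simp only: d_def left_diff_distrib sum_subtractf)
  qed
  moreover have "d 0 \<noteq> 0" using c0 by (simp add: d_def)
  ultimately show ?case by blast
qed

end

section \<open>Commutative groups: semipolynomials are polynomials of the same degree\<close>

context comm_group
begin

lemma right_diff_commute:
  assumes "a \<in> carrier G" "b \<in> carrier G" "x \<in> carrier G"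
  shows "right_diff G a (right_diff G b f) x = right_diff G b (right_diff G a f) x"
  using assms by (simp add: right_diff_def right_translate_def m_ac)

text \<open>Moves the step applied first to the last place, where the vanishing of a difference
  along it can be exploited.\<close>

lemma fold_right_diff_commute:
  assumes "a \<in> carrier G" "set us \<subseteq> carrier G" "x \<in> carrier G"
  shows "fold (right_diff G) us (right_diff G a f) x = right_diff G a (fold (right_diff G) us f) x"
  using assms(2)
proof (induction us arbitrary: f)
  case (Cons u us)
  have "fold (right_diff G) (u # us) (right_diff G a f) x
      = fold (right_diff G) us (right_diff G a (right_diff G u f)) x"
    using Cons.prems assms by (simp, intro fold_right_diff_cong) (auto simp: right_diff_commute)
  then show ?case using Cons by simp
qed simp

text \<open>The difference along \<open>a\<close> can be taken last, where it acts on a function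
  that already vanishes on the carrier.\<close>

lemma semipolynomial_of_degree_le_right_diff:
  assumes "semipolynomial_of_degree_le G n f" "a \<in> carrier G"
  shows "semipolynomial_of_degree_le G n (right_diff G a f)"
  unfolding semipolynomial_of_degree_le_def
proof (intro ballI)
  fix h x assume h: "h \<in> carrier G" and x: "x \<in> carrier G"
  have "(right_diff G h ^^ (n + 1)) (right_diff G a f) x
      = right_diff G a ((right_diff G h ^^ (n + 1)) f) x"
    unfolding funpow_right_diff_eq_fold by (rule fold_right_diff_commute) (use h x assms in auto)
  also have "\<dots> = 0"
    using assms h x
    by (simp add: semipolynomial_of_degree_le_def right_diff_def[of _ a] right_translate_def)
  finally show "(right_diff G h ^^ (n + 1)) (right_diff G a f) x = 0" .
qed

lemma semipolynomial_of_degree_le_fold_right_diff: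
  assumes "semipolynomial_of_degree_le G n f" "set us \<subseteq> carrier G"
  shows "semipolynomial_of_degree_le G n (fold (right_diff G) us f)"
  using assms by (induction us arbitrary: f) (auto simp: semipolynomial_of_degree_le_right_diff)

text \<open>Each step in \<open>us\<close> eliminates the top function of the family, so
  \<open>m\<close> steps leave only differences of \<open>F 0\<close>. The family is arbitrary in
  the induction because elimination changes every member; semipolynomiality of \<open>F 0\<close>
  serves to pass from powers of a step to the step itself.\<close>

lemma fold_right_diff_zero_if_sum_zero:
  assumes "\<And>x y. x \<in> carrier G \<Longrightarrow> y \<in> carrier G \<Longrightarrow> (\<Sum>j\<le>m. F j (x \<otimes> y [^] j)) = 0"
    and "semipolynomial_of_degree_le G n (F 0)"
    and "length us = m" "set us \<subseteq> carrier G" "x \<in> carrier G"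
  shows "fold (right_diff G) us (F 0) x = 0"
  using assms
proof (induction m arbitrary: F us x)
  case 0
  then show ?case using "0.prems"(1)[of x \<one>] by simp
next
  case (Suc m)
  then obtain u vs where us: "us = u # vs" and vs: "length vs = m" "set vs \<subseteq> carrier G"
    and u: "u \<in> carrier G"
    by (cases us) auto
  \<comment> \<open>Replacing \<open>x\<close> by \<open>x \<otimes> u [^] Suc m\<close> and
    \<open>y\<close> by \<open>inv u \<otimes> y\<close> multiplies the argument of
    \<open>F j\<close> by \<open>u [^] (Suc m - j)\<close>; subtracting the original relation thus
    turns \<open>F j\<close> into \<open>E j\<close>.\<close>
  define E where "E j = right_diff G (u [^] (Suc m - j)) (F j)" for j
  have cancel: "(a \<otimes> b) \<otimes> (inv a \<otimes> c) = c \<otimes> b"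
    if "a \<in> carrier G" "b \<in> carrier G" "c \<in> carrier G" for a b c
  proof -
    have "(a \<otimes> b) \<otimes> (inv a \<otimes> c) = a \<otimes> (inv a \<otimes> (c \<otimes> b))"
      using that m_lcomm[of b "inv a" c] m_comm[of b c] by (simp add: m_assoc)
    also have "\<dots> = c \<otimes> b" using that by (simp add: m_assoc[symmetric])
    finally show ?thesis .
  qed
  have shift: "x \<otimes> u [^] Suc m \<otimes> (inv u \<otimes> y) [^] j = x \<otimes> y [^] j \<otimes> u [^] (Suc m - j)"
    if "x \<in> carrier G" "y \<in> carrier G" "j \<le> Suc m" for x y j
  proof -
    have "u [^] Suc m = u [^] j \<otimes> u [^] (Suc m - j)"
      using u that by (simp add: nat_pow_mult del: nat_pow_Suc)
    then have "u [^] Suc m \<otimes> (inv u \<otimes> y) [^] j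
        = (u [^] j \<otimes> u [^] (Suc m - j)) \<otimes> (inv (u [^] j) \<otimes> y [^] j)"
      using u that by (simp add: nat_pow_distrib nat_pow_inv del: nat_pow_Suc)
    also have "\<dots> = y [^] j \<otimes> u [^] (Suc m - j)"
      by (rule cancel) (use u that in auto)
    finally show ?thesis using u that by (simp add: m_assoc del: nat_pow_Suc)
  qed
  have "(\<Sum>j\<le>m. E j (x \<otimes> y [^] j)) = 0" if x: "x \<in> carrier G" and y: "y \<in> carrier G" for x y
  proof -
    \<comment> \<open>The term \<open>j = Suc m\<close> can be added freely: its step is
      \<open>u [^] 0\<close>, so its difference is zero.\<close>
    have "(\<Sum>j\<le>m. E j (x \<otimes> y [^] j)) = (\<Sum>j\<le>Suc m. E j (x \<otimes> y [^] j))"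
      using x y by (simp add: E_def right_diff_def right_translate_def)
    also have "\<dots> = (\<Sum>j\<le>Suc m. F j (x \<otimes> u [^] Suc m \<otimes> (inv u \<otimes> y) [^] j))
        - (\<Sum>j\<le>Suc m. F j (x \<otimes> y [^] j))"
      unfolding sum_subtractf[symmetric]
      by (intro sum.cong refl) (use x y in \<open>simp only: shift atMost_iff E_def right_diff_def right_translate_def\<close>)
    also have "\<dots> = 0"
      using Suc.prems(1)[of "x \<otimes> u [^] Suc m" "inv u \<otimes> y"] Suc.prems(1)[OF x y] x y u
      by (simp del: nat_pow_Suc sum.atMost_Suc)
    finally show ?thesis .
  qed
  moreover have "semipolynomial_of_degree_le G n (E 0)"
    using Suc.prems(2) u by (simp add: E_def semipolynomial_of_degree_le_right_diff del: nat_pow_Suc)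
  ultimately have E0: "fold (right_diff G) vs (E 0) y = 0" if "y \<in> carrier G" for y
    using that vs by (intro Suc.IH)
  \<comment> \<open>Commuting the difference along \<open>u [^] Suc m\<close> to the outside of
    \<open>E0\<close> gives a semipolynomial that is periodic along \<open>u\<close>.\<close>
  have "right_diff G u (fold (right_diff G) vs (F 0)) x = 0"
  proof (rule right_diff_zero_if_right_diff_pow_zero[where m = "Suc m"])
    show "semipolynomial_of_degree_le G n (fold (right_diff G) vs (F 0))"
      using Suc.prems(2) vs(2) by (rule semipolynomial_of_degree_le_fold_right_diff)
    fix y assume y: "y \<in> carrier G"
    show "right_diff G (u [^] Suc m) (fold (right_diff G) vs (F 0)) y = 0"
      using E0[OF y] fold_right_diff_commute[of "u [^] Suc m" vs y "F 0"] y u vs(2)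
      by (simp add: E_def del: nat_pow_Suc)
  qed (use u Suc.prems in auto)
  then show ?case
    using fold_right_diff_commute[of u vs x "F 0"] u vs(2) Suc.prems(5) us by simp
qed

text \<open>The expanded relation has the terms 0 to \<open>n + 1\<close>; eliminating all but the
  first takes \<open>n + 1\<close> differences, exactly the number that degree at most
  \<open>n\<close> demands.\<close>

lemma polynomial_of_degree_le_if_semipolynomial:
  assumes semi: "semipolynomial_of_degree_le G n f"
  shows "polynomial_of_degree_le G n f"
  unfolding polynomial_of_degree_le_def
proof (intro allI impI ballI)
  fix hs x assume hs: "length hs = n + 1 \<and> set hs \<subseteq> carrier G" and x: "x \<in> carrier G"
  obtain c :: "nat \<Rightarrow> complex" where c0: "c 0 \<noteq> 0"
    and c: "\<And>f h x. h \<in> carrier G \<Longrightarrow> x \<in> carrier G \<Longrightarrow>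
      (right_diff G h ^^ (n + 1)) f x = (\<Sum>j\<le>n + 1. c j * f (x \<otimes> h [^] j))"
    using funpow_right_diff_expansion[of "n + 1"] by blast
  \<comment> \<open>Dividing by \<open>c 0\<close> makes \<open>F 0\<close> equal to
    \<open>f\<close> itself.\<close>
  define F where "F j = (\<lambda>x. c j / c 0 * f x)" for j
  have F0: "F 0 = f" using c0 by (simp add: F_def)
  have "fold (right_diff G) hs (F 0) x = 0"
  proof (rule fold_right_diff_zero_if_sum_zero)
    fix y z assume y: "y \<in> carrier G" and z: "z \<in> carrier G"
    have "(\<Sum>j\<le>n + 1. F j (y \<otimes> z [^] j)) = (right_diff G z ^^ (n + 1)) f y / c 0"
      unfolding c[OF z y] F_def sum_divide_distrib by simp
    also have "\<dots> = 0" using semi y z unfolding semipolynomial_of_degree_le_def by simp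
    finally show "(\<Sum>j\<le>n + 1. F j (y \<otimes> z [^] j)) = 0" .
  qed (use hs x semi F0 in auto)
  then show "fold (right_diff G) hs f x = 0" by (simp add: F0)
qed

end

section \<open>Descent of invariant functions to a quotient group\<close>

lemma (in normal) polynomial_of_degree_le_if_semipolynomial_invariant:
  fixes f :: "'a \<Rightarrow> complex"
  assumes comm: "comm_group (G Mod H)"
    and inv: "\<And>x g. x \<in> carrier G \<Longrightarrow> g \<in> H \<Longrightarrow> f (x \<otimes> g) = f x"
    and semi: "semipolynomial_of_degree_le G n f"
  shows "polynomial_of_degree_le G n f"
proof -
  interpret Q: comm_group "G Mod H" by fact
  define \<pi> where "\<pi> x = H #> x" for x
  \<comment> \<open>The function induced on cosets, read off at an arbitrary representative;
    invariance makes the choice immaterial.\<close>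
  define F where "F C = f (SOME x. x \<in> C)" for C
  have hom: "\<pi> \<in> hom G (G Mod H)"
    using r_coset_hom_Mod by (simp add: \<pi>_def[abs_def])
  have carrier: "carrier (G Mod H) = \<pi> ` carrier G"
    by (auto simp: FactGroup_def RCOSETS_def \<pi>_def)
  have F: "F (\<pi> x) = f x" if x: "x \<in> carrier G" for x
  proof -
    have "x \<in> H #> x" using x by (rule rcos_self[OF _ is_subgroup])
    moreover define y where "y = (SOME y. y \<in> H #> x)"
    ultimately have "y \<in> H #> x" by (metis someI)
    \<comment> \<open>The quotient consists of right cosets, while invariance concerns
      multiplication from the right; normality turns the right coset into a left one.\<close>
    then have "y \<in> x <# H" using coset_eq x by blast
    then obtain g where "g \<in> H" "y = x \<otimes> g" by (auto simp: l_coset_def)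
    then show ?thesis using inv x by (simp add: F_def \<pi>_def y_def[symmetric])
  qed
  \<comment> \<open>Transfers the semipolynomial hypothesis to the quotient and the polynomial
    conclusion back.\<close>
  have pullback: "fold (right_diff G) hs f x = fold (right_diff (G Mod H)) (map \<pi> hs) F (\<pi> x)"
    if "set hs \<subseteq> carrier G" "x \<in> carrier G" for hs x
  proof -
    have "fold (right_diff G) hs f x = fold (right_diff G) hs (\<lambda>y. F (\<pi> y)) x"
      using that by (intro fold_right_diff_cong) (auto simp: F)
    then show ?thesis using fold_right_diff_hom[OF hom that, of F] by simp
  qed
  have "semipolynomial_of_degree_le (G Mod H) n F"
    unfolding semipolynomial_of_degree_le_def carrier
  proof (clarify)
    fix h x assume h: "h \<in> carrier G" and x: "x \<in> carrier G"
    have "(right_diff (G Mod H) (\<pi> h) ^^ (n + 1)) F (\<pi> x) = (right_diff G h ^^ (n + 1)) f x"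
      unfolding funpow_right_diff_eq_fold Q.funpow_right_diff_eq_fold
      using pullback[of "replicate (n + 1) h" x] h x by (simp add: set_replicate_conv_if)
    then show "(right_diff (G Mod H) (\<pi> h) ^^ (n + 1)) F (\<pi> x) = 0"
      using semi h x by (simp add: semipolynomial_of_degree_le_def)
  qed
  then have "polynomial_of_degree_le (G Mod H) n F"
    by (rule Q.polynomial_of_degree_le_if_semipolynomial)
  then have vanish: "fold (right_diff (G Mod H)) hs F (\<pi> x) = 0"
    if "length hs = n + 1" "set hs \<subseteq> \<pi> ` carrier G" "x \<in> carrier G" for hs x
    using that by (simp add: polynomial_of_degree_le_def carrier)
  show ?thesis
    unfolding polynomial_of_degree_le_def by (auto simp: pullback intro!: vanish imageI)
qed

section \<open>Closures, compact elements and invariance in a topological group\<close>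

context topological_group
begin

lemma continuous_map_left_mult:
  assumes "a \<in> carrier G"
  shows "continuous_map T T (\<lambda>x. a \<otimes> x)"
proof -
  have "continuous_map T (prod_topology T T) (\<lambda>x. (a, x))"
    using assms topspace_eq by (intro continuous_map_pairedI) auto
  from continuous_map_compose[OF this continuous_mult] show ?thesis by (simp add: o_def)
qed

lemma continuous_map_right_mult:
  assumes "a \<in> carrier G"
  shows "continuous_map T T (\<lambda>x. x \<otimes> a)"
proof -
  have "continuous_map T (prod_topology T T) (\<lambda>x. (x, a))"
    using assms topspace_eq by (intro continuous_map_pairedI) auto
  from continuous_map_compose[OF this continuous_mult] show ?thesis by (simp add: o_def)
qed

lemma continuous_map_conj:
  assumes "a \<in> carrier G" "b \<in> carrier G"
  shows "continuous_map T T (\<lambda>x. a \<otimes> x \<otimes> b)"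
  using continuous_map_compose[OF continuous_map_left_mult continuous_map_right_mult, OF assms]
  by (simp add: o_def)

lemma homeomorphic_map_conj:
  assumes a: "a \<in> carrier G"
  shows "homeomorphic_map T T (\<lambda>x. a \<otimes> x \<otimes> inv a)"
proof -
  have "a \<otimes> (inv a \<otimes> x \<otimes> a) \<otimes> inv a = x" "inv a \<otimes> (a \<otimes> x \<otimes> inv a) \<otimes> a = x"
    if "x \<in> carrier G" for x
    using a that by (simp_all add: m_assoc) (simp_all add: m_assoc[symmetric])
  then have "homeomorphic_maps T T (\<lambda>x. a \<otimes> x \<otimes> inv a) (\<lambda>x. inv a \<otimes> x \<otimes> a)"
    using a continuous_map_conj[of a "inv a"] continuous_map_conj[of "inv a" a] topspace_eq
    by (simp add: homeomorphic_maps_def)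
  then show ?thesis by (auto simp: homeomorphic_map_maps)
qed

lemma subgroup_closure_of:
  assumes H: "subgroup H G"
  shows "subgroup (T closure_of H) G"
proof
  show "T closure_of H \<subseteq> carrier G"
    using closure_of_subset_topspace[of T H] topspace_eq by simp
  have HT: "H \<subseteq> T closure_of H"
    using subgroup.subset[OF H] topspace_eq by (intro closure_of_subset) simp
  then show "\<one> \<in> T closure_of H" using subgroup.one_closed[OF H] by blast
next
  fix x y assume "x \<in> T closure_of H" "y \<in> T closure_of H"
  \<comment> \<open>The closure of \<open>H \<times> H\<close> is the product of the closures, so
    joint continuity of multiplication applies.\<close>
  then have "x \<otimes> y \<in> (\<lambda>(x, y). x \<otimes> y) ` (prod_topology T T closure_of (H \<times> H))"
    by (force simp: closure_of_Times)
  also have "\<dots> \<subseteq> T closure_of ((\<lambda>(x, y). x \<otimes> y) ` (H \<times> H))"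
    by (rule continuous_map_image_closure_subset[OF continuous_mult])
  also have "\<dots> \<subseteq> T closure_of H"
    using subgroup.m_closed[OF H] by (intro closure_of_mono) auto
  finally show "x \<otimes> y \<in> T closure_of H" .
next
  fix x assume "x \<in> T closure_of H"
  then have "inv x \<in> (\<lambda>x. inv x) ` (T closure_of H)" by blast
  also have "\<dots> \<subseteq> T closure_of ((\<lambda>x. inv x) ` H)"
    by (rule continuous_map_image_closure_subset[OF continuous_inv])
  also have "\<dots> \<subseteq> T closure_of H"
    using subgroup.m_inv_closed[OF H] by (intro closure_of_mono) auto
  finally show "inv x \<in> T closure_of H" .
qed

lemma normal_closure_of:
  assumes H: "H \<lhd> G"
  shows "T closure_of H \<lhd> G"
proof (rule normal_invI)
  show "subgroup (T closure_of H) G"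
    using H by (intro subgroup_closure_of) (simp add: normal_inv_iff)
  fix a h assume a: "a \<in> carrier G" and h: "h \<in> T closure_of H"
  then have "a \<otimes> h \<otimes> inv a \<in> (\<lambda>x. a \<otimes> x \<otimes> inv a) ` (T closure_of H)" by blast
  also have "\<dots> \<subseteq> T closure_of ((\<lambda>x. a \<otimes> x \<otimes> inv a) ` H)"
    using a by (intro continuous_map_image_closure_subset continuous_map_conj) auto
  also have "\<dots> \<subseteq> T closure_of H"
    using H a by (intro closure_of_mono) (auto simp: normal_inv_iff)
  finally show "a \<otimes> h \<otimes> inv a \<in> T closure_of H" .
qed

lemma compact_elements_subset: "compact_elements G T \<subseteq> carrier G"
  by (auto simp: compact_elements_def)

text \<open>Conjugation is an automorphism and a homeomorphism, so it carries the closure of the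
  cyclic group of \<open>h\<close> onto that of the conjugate.\<close>

lemma conj_compact_element:
  assumes a: "a \<in> carrier G" and h: "h \<in> compact_elements G T"
  shows "a \<otimes> h \<otimes> inv a \<in> compact_elements G T"
proof -
  let ?c = "\<lambda>x. a \<otimes> x \<otimes> inv a"
  have hG: "h \<in> carrier G" and cpt: "compactin T (T closure_of (generate G {h}))"
    using h by (auto simp: compact_elements_def)
  have "generate G {?c h} = ?c ` generate G {h}"
    using group_hom.generate_img[OF group_hom_conj[OF a], of "{h}"] hG by simp
  moreover have "generate G {h} \<subseteq> topspace T"
    using generate_incl[of "{h}"] hG topspace_eq by simp
  ultimately have "T closure_of (generate G {?c h}) = ?c ` (T closure_of (generate G {h}))"
    using homeomorphic_map_closure_of[OF homeomorphic_map_conj[OF a]] by simp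
  then show ?thesis
    using image_compactin[OF cpt continuous_map_conj[of a "inv a"]] a hG
    by (simp add: compact_elements_def)
qed

lemma compact_closed_subgroup_normal: "compact_closed_subgroup G T \<lhd> G"
  unfolding compact_closed_subgroup_def
  by (intro normal_closure_of normal_generateI compact_elements_subset conj_compact_element)

lemma semipolynomial_compact_element_invariant:
  fixes f :: "'a \<Rightarrow> complex"
  assumes cont: "continuous_map T euclidean f" and semi: "semipolynomial_of_degree_le G n f"
    and h: "h \<in> compact_elements G T" and x: "x \<in> carrier G"
  shows "f (x \<otimes> h) = f x"
proof -
  let ?K = "T closure_of (generate G {h})"
  have hG: "h \<in> carrier G" and cpt: "compactin T ?K"
    using h by (auto simp: compact_elements_def)
  have gen: "generate G {h} \<subseteq> ?K"
    using generate_incl[of "{h}"] hG topspace_eq by (intro closure_of_subset) simp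
  have pow: "h [^] k \<in> ?K" for k :: nat
  proof -
    have "h [^] int k \<in> generate G {h}" unfolding generate_pow[OF hG] by blast
    then show ?thesis using gen by (auto simp: int_pow_int)
  qed
  have "right_diff G h f x = 0"
  proof (rule right_diff_zero_if_bounded[OF hG _ _ x])
    fix y assume y: "y \<in> carrier G"
    show "(right_diff G h ^^ (n + 1)) f y = 0"
      using semi hG y by (auto simp: semipolynomial_of_degree_le_def)
    \<comment> \<open>For fixed \<open>y\<close> this map is bounded on the compact set
      \<open>?K\<close>, which contains all powers of \<open>h\<close>.\<close>
    have "continuous_map T euclidean (\<lambda>g. f (y \<otimes> g))"
      using continuous_map_compose[OF continuous_map_left_mult[OF y] cont] by (simp add: o_def)
    from image_compactin[OF cpt this] have "bounded ((\<lambda>g. f (y \<otimes> g)) ` ?K)"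
      by (simp add: compact_imp_bounded)
    then show "bounded (range (\<lambda>k::nat. f (y \<otimes> h [^] k)))"
      by (rule bounded_subset) (use pow in blast)
  qed
  then show ?thesis by (simp add: right_diff_def right_translate_def)
qed

text \<open>The right periods of \<open>f\<close> form a subgroup containing the compact elements,
  hence the subgroup they generate. For each fixed \<open>x\<close> the condition on
  \<open>g\<close> is closed, so it passes to the closure.\<close>

lemma semipolynomial_compact_closed_subgroup_invariant:
  fixes f :: "'a \<Rightarrow> complex"
  assumes cont: "continuous_map T euclidean f" and semi: "semipolynomial_of_degree_le G n f"
    and g: "g \<in> compact_closed_subgroup G T" and x: "x \<in> carrier G"
  shows "f (x \<otimes> g) = f x"
proof -
  let ?S = "{g \<in> carrier G. \<forall>x\<in>carrier G. f (x \<otimes> g) = f x}"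
  have "subgroup ?S G"
  proof
    fix g assume g: "g \<in> ?S"
    have "f (y \<otimes> inv g) = f y" if y: "y \<in> carrier G" for y
    proof -
      \<comment> \<open>Invariance under \<open>g\<close> is applied at the point
        \<open>y \<otimes> inv g\<close>.\<close>
      have "f (y \<otimes> inv g) = f (y \<otimes> inv g \<otimes> g)" using g y by simp
      then show ?thesis using g y by (simp add: m_assoc)
    qed
    then show "inv g \<in> ?S" using g by simp
  qed (auto simp: m_assoc[symmetric])
  moreover have "compact_elements G T \<subseteq> ?S"
    using semipolynomial_compact_element_invariant[OF cont semi] compact_elements_subset by auto
  ultimately have gen: "generate G (compact_elements G T) \<subseteq> ?S"
    by (intro generate_subgroup_incl)
  have "continuous_map T euclidean (\<lambda>g. f (x \<otimes> g))"
    using continuous_map_compose[OF continuous_map_left_mult[OF x] cont] by (simp add: o_def)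
  from closedin_continuous_map_preimage[OF this, of "{f x}"]
  have "closedin T {g \<in> topspace T. f (x \<otimes> g) \<in> {f x}}" by simp
  then have "T closure_of (generate G (compact_elements G T)) \<subseteq> {g \<in> topspace T. f (x \<otimes> g) \<in> {f x}}"
    using gen x topspace_eq by (intro closure_of_minimal) auto
  then show ?thesis using g by (auto simp: compact_closed_subgroup_def)
qed

end

theorem corollary3p14:
  fixes G :: "('a, 'b) monoid_scheme" and T :: "'a topology"
  assumes "topological_group G T"
  shows "compact_closed_subgroup G T \<lhd> G \<and>
    (carrier G = compact_closed_subgroup G T \<longrightarrow>
      (\<forall>f :: 'a \<Rightarrow> complex. continuous_map T euclidean f \<and> semipolynomial_on_group G f \<longrightarrow>
        (\<exists>c. \<forall>x\<in>carrier G. f x = c))) \<and>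
    (comm_group (G Mod compact_closed_subgroup G T) \<longrightarrow>
      (\<forall>f :: 'a \<Rightarrow> complex. continuous_map T euclidean f \<and> semipolynomial_on_group G f \<longrightarrow>
        polynomial_on_group G f))"
proof -
  interpret topological_group G T by fact
  show ?thesis
  proof (intro conjI impI allI)
    show "compact_closed_subgroup G T \<lhd> G" by (rule compact_closed_subgroup_normal)
  next
    fix f :: "'a \<Rightarrow> complex"
    assume eq: "carrier G = compact_closed_subgroup G T"
      and "continuous_map T euclidean f \<and> semipolynomial_on_group G f"
    then obtain n where "continuous_map T euclidean f" "semipolynomial_of_degree_le G n f"
      by (auto simp: semipolynomial_on_group_def)
    \<comment> \<open>Every \<open>x\<close> is the identity times an element of the subgroup, so
      invariance at the identity fixes all values of \<open>f\<close>.\<close>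
    from semipolynomial_compact_closed_subgroup_invariant[OF this _ one_closed]
    have "f x = f \<one>\<^bsub>G\<^esub>" if "x \<in> carrier G" for x
      using that eq by (metis l_one)
    then show "\<exists>c. \<forall>x\<in>carrier G. f x = c" by blast
  next
    fix f :: "'a \<Rightarrow> complex"
    assume comm: "comm_group (G Mod compact_closed_subgroup G T)"
      and "continuous_map T euclidean f \<and> semipolynomial_on_group G f"
    then obtain n where cont: "continuous_map T euclidean f"
      and semi: "semipolynomial_of_degree_le G n f"
      by (auto simp: semipolynomial_on_group_def)
    have "polynomial_of_degree_le G n f"
      using normal.polynomial_of_degree_le_if_semipolynomial_invariant
        [OF compact_closed_subgroup_normal comm _ semi]
        semipolynomial_compact_closed_subgroup_invariant[OF cont semi]
      by blast
    then show "polynomial_on_group G f" by (auto simp: polynomial_on_group_def)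
  qed
qed

end
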